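(* Let $G$ be a finite group of order $n$ with Cayley table $L$, and suppose $L$ contains a maximal partial transversal of length $\ell<\frac35 n$. Then $n$ is even, $G$ contains a subgroup of index $2$, and $\ell-\frac n2$ is even.
   Context: The Cayley table of $G$ is the Latin square with rows and columns indexed by $G$ whose cell $(g,h)$ contains $gh$, viewed as the set of triples $(g,h,gh)$. A partial transversal is a set of triples containing at most one triple in each row, at most one in each column, and at most one with each symbol; its length is its number of triples. It is maximal if not contained in a longer partial transversal. *)

theory Defs
  imports "HOL-Algebra.Algebra"
begin

definition cayley_table :: "('a, 'b) monoid_scheme \<Rightarrow> ('a \<times> 'a \<times> 'a) set" where
  "cayley_table G = {(g, h, g \<otimes>\<^bsub>G\<^esub> h) | g h. g \<in> carrier G \<and> h \<in> carrier G}"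

text \<open>A Latin square is viewed as its set of triples (row, column, symbol).\<close>

definition partial_transversal :: "('r \<times> 'c \<times> 's) set \<Rightarrow> ('r \<times> 'c \<times> 's) set \<Rightarrow> bool" where
  "partial_transversal L T \<longleftrightarrow> T \<subseteq> L \<and>
     inj_on (\<lambda>(r, c, s). r) T \<and> inj_on (\<lambda>(r, c, s). c) T \<and> inj_on (\<lambda>(r, c, s). s) T"

text \<open>The length of a partial transversal is its cardinality, which is only meaningful
  for finite sets of triples; here all Latin squares are finite.\<close>

definition maximal_partial_transversal ::
  "('r \<times> 'c \<times> 's) set \<Rightarrow> ('r \<times> 'c \<times> 's) set \<Rightarrow> bool" where
  "maximal_partial_transversal L T \<longleftrightarrow> partial_transversal L T \<and>
     \<not> (\<exists>T'. partial_transversal L T' \<and> T \<subseteq> T' \<and> card T < card T')"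

end

theory Submission
  imports Defs
begin

text \<open>Let \<open>R\<close>, \<open>C\<close>, \<open>S\<close> be the rows, columns and symbols missed by \<open>T\<close>, each of size
  \<open>d = n - l > 2n/5\<close>. Maximality says that \<open>RC\<close> is disjoint from \<open>S\<close>, so \<open>|RC| \<le> l < 3d/2\<close>.
  Any two translates \<open>Rc\<close>, \<open>Rc'\<close> then share more than half of their elements, and likewise for
  \<open>rC\<close>, \<open>r'C\<close>; as in Freiman's 3/2-theorem this forces \<open>R\<^sup>-\<^sup>1R = CC\<^sup>-\<^sup>1\<close> to be a subgroup \<open>H\<close> with
  \<open>d \<le> |H| < 2d \<le> n\<close>, so \<open>H\<close> has index 2. Now \<open>R\<close>, \<open>C\<close>, \<open>S\<close> each lie in one coset of \<open>H\<close>, and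
  by pigeonhole \<open>S\<close> lies in the coset opposite to \<open>RC\<close>. Multiplying the sign character of \<open>H\<close>
  over all rows, columns and symbols of \<open>T\<close> gives \<open>(-1)^(3n/2) = (-1)^d\<close>.\<close>

section \<open>Overlaps of large subsets of a finite set\<close>

lemma card_Int_gt_half:
  assumes "finite U" "P \<subseteq> U" "Q \<subseteq> U" "card P = k" "card Q = k" "2 * card U < 3 * k"
  shows "k < 2 * card (P \<inter> Q)"
proof -
  have "finite P" "finite Q" using assms finite_subset by auto
  then have "card (P \<union> Q) + card (P \<inter> Q) = 2 * k"
    using card_Un_Int[of P Q] assms by simp
  moreover have "card (P \<union> Q) \<le> card U" using assms by (intro card_mono) auto
  ultimately show ?thesis using assms(6) by linarith
qed

lemma Int_nonempty_if_card_gt: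
  assumes "finite U" "P \<subseteq> U" "Q \<subseteq> U" "card U < card P + card Q"
  shows "P \<inter> Q \<noteq> {}"
proof
  assume "P \<inter> Q = {}"
  moreover have "finite P" "finite Q" using assms finite_subset by auto
  ultimately have "card (P \<union> Q) = card P + card Q" by (simp add: card_Un_disjoint)
  moreover have "card (P \<union> Q) \<le> card U" using assms by (intro card_mono) auto
  ultimately show False using assms(4) by linarith
qed

section \<open>Sets with a small product set\<close>

context group
begin

text \<open>The translates of \<open>A\<close> by \<open>b\<close> and by \<open>b'\<close> both lie
  in \<open>A <#> B\<close>, which has fewer than 3/2 |A| elements, so they share more than |A|/2. A
  common element \<open>a \<otimes> b = a' \<otimes> b'\<close> says that right multiplication by
  \<open>b \<otimes> inv b'\<close> sends \<open>a\<close> to \<open>a'\<close>, hence back into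
  \<open>A\<close>.\<close>

lemma card_right_overlap_gt_half:
  assumes "finite A" "finite B" "A \<subseteq> carrier G" "B \<subseteq> carrier G"
    and small: "2 * card (A <#> B) < 3 * card A"
    and b: "b \<in> B" "b' \<in> B"
  shows "card A < 2 * card {a \<in> A. a \<otimes> (b \<otimes> inv b') \<in> A}"
proof -
  have bG: "b \<in> carrier G" "b' \<in> carrier G" using assms by auto
  have card_translate: "card ((\<lambda>a. a \<otimes> c) ` A) = card A" if "c \<in> carrier G" for c
    using that assms(3) by (intro card_image inj_onI) (metis r_cancel subsetD)
  have "finite (A <#> B)" using assms by (auto simp: set_mult_def)
  then have "card A < 2 * card ((\<lambda>a. a \<otimes> b) ` A \<inter> (\<lambda>a. a \<otimes> b') ` A)"
    by (rule card_Int_gt_half[OF _ _ _ card_translate card_translate small])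
      (use b bG in \<open>auto simp: set_mult_def\<close>)
  also have "(\<lambda>a. a \<otimes> b) ` A \<inter> (\<lambda>a. a \<otimes> b') ` A \<subseteq> (\<lambda>a. a \<otimes> b) ` {a \<in> A. a \<otimes> (b \<otimes> inv b') \<in> A}"
  proof
    fix x assume "x \<in> (\<lambda>a. a \<otimes> b) ` A \<inter> (\<lambda>a. a \<otimes> b') ` A"
    then obtain a a' where a: "a \<in> A" "a' \<in> A" "x = a \<otimes> b" "x = a' \<otimes> b'" by auto
    then have G: "a \<in> carrier G" "a' \<in> carrier G" using assms(3) by auto
    have "a \<otimes> (b \<otimes> inv b') = a' \<otimes> b' \<otimes> inv b'" using a G bG by (metis inv_closed m_assoc)
    also have "\<dots> = a'" using G bG by (simp add: m_assoc)
    finally show "x \<in> (\<lambda>a. a \<otimes> b) ` {a \<in> A. a \<otimes> (b \<otimes> inv b') \<in> A}" using a by auto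
  qed
  then have "card ((\<lambda>a. a \<otimes> b) ` A \<inter> (\<lambda>a. a \<otimes> b') ` A) \<le> card {a \<in> A. a \<otimes> (b \<otimes> inv b') \<in> A}"
    using assms(1) by (intro surj_card_le) auto
  finally show ?thesis by simp
qed

text \<open>The mirror image, with left translates of \<open>B\<close>; the bound is therefore
  measured against \<open>card B\<close>.\<close>

lemma card_left_overlap_gt_half:
  assumes "finite A" "finite B" "A \<subseteq> carrier G" "B \<subseteq> carrier G"
    and small: "2 * card (A <#> B) < 3 * card B"
    and a: "a \<in> A" "a' \<in> A"
  shows "card B < 2 * card {b \<in> B. (inv a \<otimes> a') \<otimes> b \<in> B}"
proof -
  have aG: "a \<in> carrier G" "a' \<in> carrier G" using assms by auto
  have card_translate: "card ((\<lambda>b. c \<otimes> b) ` B) = card B" if "c \<in> carrier G" for c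
    using that assms(4) by (intro card_image inj_onI) (metis l_cancel subsetD)
  have "finite (A <#> B)" using assms by (auto simp: set_mult_def)
  then have "card B < 2 * card ((\<lambda>b. a' \<otimes> b) ` B \<inter> (\<lambda>b. a \<otimes> b) ` B)"
    by (rule card_Int_gt_half[OF _ _ _ card_translate card_translate small])
      (use a aG in \<open>auto simp: set_mult_def\<close>)
  also have "(\<lambda>b. a' \<otimes> b) ` B \<inter> (\<lambda>b. a \<otimes> b) ` B \<subseteq> (\<lambda>b. a' \<otimes> b) ` {b \<in> B. (inv a \<otimes> a') \<otimes> b \<in> B}"
  proof
    fix x assume "x \<in> (\<lambda>b. a' \<otimes> b) ` B \<inter> (\<lambda>b. a \<otimes> b) ` B"
    then obtain b b' where b: "b \<in> B" "b' \<in> B" "x = a' \<otimes> b" "x = a \<otimes> b'" by auto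
    then have G: "b \<in> carrier G" "b' \<in> carrier G" using assms(4) by auto
    have "(inv a \<otimes> a') \<otimes> b = inv a \<otimes> (a \<otimes> b')" using b G aG by (metis inv_closed m_assoc)
    also have "\<dots> = b'" using G aG by (simp add: m_assoc[symmetric])
    finally show "x \<in> (\<lambda>b. a' \<otimes> b) ` {b \<in> B. (inv a \<otimes> a') \<otimes> b \<in> B}" using b by auto
  qed
  then have "card ((\<lambda>b. a' \<otimes> b) ` B \<inter> (\<lambda>b. a \<otimes> b) ` B) \<le> card {b \<in> B. (inv a \<otimes> a') \<otimes> b \<in> B}"
    using assms(2) by (intro surj_card_le) auto
  finally show ?thesis by simp
qed

text \<open>A two-set form of Freiman's 3/2-theorem; the subgroup is \<open>DB\<close>, the set of
  right quotients of \<open>B\<close>. Each of its elements moves more than half of \<open>A\<close>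
  into \<open>A\<close>. That two majorities of \<open>A\<close> must meet gives closure under
  products, and counting these moves bounds the size.\<close>

lemma small_product_subgroup:
  assumes fin: "finite A" "finite B" and sub: "A \<subseteq> carrier G" "B \<subseteq> carrier G"
    and card_eq: "card A = card B"
    and small: "2 * card (A <#> B) < 3 * card A"
  obtains H where "subgroup H G" "card H < 2 * card A"
    "\<And>a a'. a \<in> A \<Longrightarrow> a' \<in> A \<Longrightarrow> inv a \<otimes> a' \<in> H"
    "\<And>b b'. b \<in> B \<Longrightarrow> b' \<in> B \<Longrightarrow> b \<otimes> inv b' \<in> H"
proof -
  define DA where "DA = {inv a \<otimes> a' | a a'. a \<in> A \<and> a' \<in> A}"
  define DB where "DB = {b \<otimes> inv b' | b b'. b \<in> B \<and> b' \<in> B}"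
  have DA_G: "DA \<subseteq> carrier G" and DB_G: "DB \<subseteq> carrier G" using sub by (auto simp: DA_def DB_def)
  \<comment> \<open>The strict bound \<open>small\<close> excludes an empty \<open>A\<close>, for
    which its right side would be 0.\<close>
  have "card A > 0" using small by linarith
  then obtain b0 where 0: "b0 \<in> B"
    using card_eq by (metis card_gt_0_iff ex_in_conv)
  have one_DB: "\<one> \<in> DB"
    using 0 sub by (auto simp: DB_def intro!: exI[of _ b0])
  have inv_DB: "inv g \<in> DB" if g: "g \<in> DB" for g
  proof -
    obtain b b' where b: "b \<in> B" "b' \<in> B" "g = b \<otimes> inv b'" using g by (auto simp: DB_def)
    then have "inv g = b' \<otimes> inv b" using sub by (simp add: inv_mult_group subset_iff)
    then show ?thesis using b by (auto simp: DB_def)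
  qed
  have overlap_DB: "card A < 2 * card {a \<in> A. a \<otimes> g \<in> A}" if "g \<in> DB" for g
    using that card_right_overlap_gt_half[OF fin sub small] by (auto simp: DB_def)
  have overlap_DA: "card B < 2 * card {b \<in> B. g \<otimes> b \<in> B}" if "g \<in> DA" for g
    using that card_left_overlap_gt_half[OF fin sub] small card_eq by (auto simp: DA_def)
  \<comment> \<open>The majorities belonging to \<open>g\<close> and \<open>h\<close> share some
    \<open>a\<close>, and in the quotient of \<open>a \<otimes> g\<close> and
    \<open>a \<otimes> h\<close> this \<open>a\<close> cancels.\<close>
  have DB_DA: "inv g \<otimes> h \<in> DA" if "g \<in> DB" "h \<in> DB" for g h
  proof -
    have "{a \<in> A. a \<otimes> g \<in> A} \<inter> {a \<in> A. a \<otimes> h \<in> A} \<noteq> {}"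
      using overlap_DB[OF that(1)] overlap_DB[OF that(2)] fin
      by (intro Int_nonempty_if_card_gt[of A]) auto
    then obtain a where a: "a \<in> A" "a \<otimes> g \<in> A" "a \<otimes> h \<in> A" by auto
    have G: "a \<in> carrier G" "g \<in> carrier G" "h \<in> carrier G" using a sub DB_G that by auto
    have "inv a \<otimes> (a \<otimes> h) = h" using G by (simp add: m_assoc[symmetric])
    then have "inv g \<otimes> h = inv (a \<otimes> g) \<otimes> (a \<otimes> h)" using G by (simp add: inv_mult_group m_assoc)
    then show ?thesis using a unfolding DA_def by blast
  qed
  \<comment> \<open>Here a single \<open>b\<close> that \<open>g\<close> keeps inside
    \<open>B\<close> is enough: \<open>g\<close> is the quotient of \<open>g \<otimes> b\<close> by
    \<open>b\<close>.\<close>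
  have DA_DB: "g \<in> DB" if "g \<in> DA" for g
  proof -
    have "card {b \<in> B. g \<otimes> b \<in> B} \<noteq> 0" using overlap_DA[OF that] by linarith
    then have "{b \<in> B. g \<otimes> b \<in> B} \<noteq> {}" by (metis card.empty)
    then obtain b where b: "b \<in> B" "g \<otimes> b \<in> B" by auto
    then have "g = (g \<otimes> b) \<otimes> inv b" using sub DA_G that by (simp add: m_assoc subset_iff)
    then show ?thesis using b unfolding DB_def by blast
  qed
  \<comment> \<open>Feeding \<open>inv g\<close> to \<open>DB_DA\<close> turns its quotient into the
    product, and \<open>DA_DB\<close> leads back to \<open>DB\<close>.\<close>
  have mult: "g \<otimes> h \<in> DB" if "g \<in> DB" "h \<in> DB" for g h
    using DA_DB[OF DB_DA[OF inv_DB[OF that(1)] that(2)]] that DB_G by (simp add: subset_iff)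
  have "subgroup DB G"
    by (rule subgroupI) (use DB_G one_DB inv_DB mult in auto)
  moreover have "card DB < 2 * card A"
  proof -
    have fin_DB: "finite DB"
      unfolding DB_def using finite_image_set2[of "\<lambda>b. b \<in> B" "\<lambda>b. b \<in> B" "\<lambda>b b'. b \<otimes> inv b'"] fin
      by simp
    \<comment> \<open>Double counting: a pair \<open>(g, a)\<close> is recovered from
      \<open>(a, a \<otimes> g)\<close>, so there are at most |A|^2 pairs, while each
      \<open>g\<close> in \<open>DB\<close> contributes more than |A|/2 of them.\<close>
    let ?P = "SIGMA g:DB. {a \<in> A. a \<otimes> g \<in> A}"
    have "card ?P \<le> card (A \<times> A)"
    proof (rule card_inj_on_le[where f = "\<lambda>(g, a). (a, a \<otimes> g)"])
      show "inj_on (\<lambda>(g, a). (a, a \<otimes> g)) ?P"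
        using DB_G sub by (auto simp: inj_on_def subset_iff)
    qed (use fin in auto)
    then have le: "(\<Sum>g\<in>DB. card {a \<in> A. a \<otimes> g \<in> A}) \<le> card A * card A"
      using fin_DB fin by (simp add: card_cartesian_product)
    have "card DB * card A = (\<Sum>g\<in>DB. card A)" by simp
    also have "\<dots> < (\<Sum>g\<in>DB. 2 * card {a \<in> A. a \<otimes> g \<in> A})"
      using fin_DB one_DB overlap_DB by (intro sum_strict_mono) auto
    also have "\<dots> \<le> 2 * card A * card A"
      using le by (simp add: sum_distrib_left[symmetric])
    finally show ?thesis by simp
  qed
  moreover have "inv a \<otimes> a' \<in> DB" if "a \<in> A" "a' \<in> A" for a a'
    using DA_DB that by (auto simp: DA_def)
  moreover have "b \<otimes> inv b' \<in> DB" if "b \<in> B" "b' \<in> B" for b b'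
    using that by (auto simp: DB_def)
  ultimately show ?thesis by (rule that)
qed

section \<open>Subgroups of index two and their sign character\<close>

text \<open>For \<open>x\<close> outside \<open>H\<close>, the coset of \<open>x\<close> avoids
  \<open>H\<close> and has the size of the complement, so it fills the complement. This is what
  makes the sign that is 1 on \<open>H\<close> and -1 off \<open>H\<close> multiplicative.\<close>

lemma half_subgroup_mult_mem:
  assumes fin: "finite (carrier G)" and H: "subgroup H G" and half: "2 * card H = order G"
    and x: "x \<in> carrier G" and y: "y \<in> carrier G"
  shows "x \<otimes> y \<in> H \<longleftrightarrow> (x \<in> H \<longleftrightarrow> y \<in> H)"
proof (cases "x \<in> H")
  case True
  then show ?thesis
    using subgroup.m_closed[OF H] subgroup.m_inv_closed[OF H] x y
    by (metis inv_solve_left' m_closed)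
next
  case False
  have HG: "H \<subseteq> carrier G" using H by (rule subgroup.subset)
  have not_mem: "x \<otimes> z \<notin> H" if "z \<in> H" for z
    using that False subgroup.m_closed[OF H] subgroup.m_inv_closed[OF H] x HG
    by (metis inv_solve_right' subsetD m_closed)
  have "(\<lambda>z. x \<otimes> z) ` H = carrier G - H"
  proof (rule card_subset_eq)
    show "(\<lambda>z. x \<otimes> z) ` H \<subseteq> carrier G - H" using not_mem x HG by auto
    have "card ((\<lambda>z. x \<otimes> z) ` H) = card H"
      using x HG by (intro card_image inj_onI) (metis l_cancel subsetD)
    also have "\<dots> = card (carrier G - H)"
      using half HG fin by (simp add: card_Diff_subset finite_subset order_def)
    finally show "card ((\<lambda>z. x \<otimes> z) ` H) = card (carrier G - H)" .
  qed (use fin in simp)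
  then have coset: "carrier G - H \<subseteq> (\<lambda>z. x \<otimes> z) ` H" by simp
  have "x \<otimes> y \<in> H" if "y \<notin> H"
  proof (rule ccontr)
    assume "x \<otimes> y \<notin> H"
    then have "x \<otimes> y \<in> (\<lambda>z. x \<otimes> z) ` H" using coset x y by auto
    then obtain z where "z \<in> H" "x \<otimes> y = x \<otimes> z" by auto
    then show False using that x y HG by auto
  qed
  then show ?thesis using False not_mem by blast
qed

text \<open>The complement of \<open>H\<close> gives one factor -1 per element and is as large as
  \<open>H\<close>. The rows, columns and symbols of \<open>G\<close> all have this same total
  sign.\<close>

lemma half_subgroup_sign_prod:
  fixes \<chi> :: "'a \<Rightarrow> int"
  assumes fin: "finite (carrier G)" and H: "subgroup H G" and half: "2 * card H = order G"
  defines "\<chi> \<equiv> \<lambda>x. if x \<in> H then 1 else -1"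
  shows "prod \<chi> (carrier G) = (-1) ^ card H"
proof -
  have HG: "H \<subseteq> carrier G" using H by (rule subgroup.subset)
  have "prod \<chi> (carrier G) = prod \<chi> (carrier G - H) * prod \<chi> H"
    using fin HG by (rule prod.subset_diff[rotated])
  also have "\<dots> = (-1) ^ card (carrier G - H)" by (simp add: \<chi>_def)
  also have "card (carrier G - H) = card H"
    using half HG fin by (simp add: card_Diff_subset finite_subset order_def)
  finally show ?thesis .
qed

lemma card_rcosets_half_subgroup:
  assumes fin: "finite (carrier G)" and H: "subgroup H G" and half: "2 * card H = order G"
  shows "card (rcosets H) = 2"
proof -
  have "card (rcosets H) * card H = 2 * card H" using lagrange[OF H] half by simp
  moreover have "order G > 0" using fin by (simp add: order_gt_0_iff_finite)
  then have "card H > 0" using half by simp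
  ultimately show ?thesis by simp
qed

text \<open>Solving \<open>r \<otimes> c = s\<close> means finding a common element of
  \<open>C\<close> and the set of all \<open>inv x \<otimes> s\<close>; together these are too large
  to be disjoint inside \<open>U\<close>. It serves to contradict maximality, once with
  \<open>U\<close> the whole group and once with \<open>U\<close> a coset of
  \<open>H\<close>.\<close>

lemma mult_hits_if_card_gt:
  assumes U: "finite U" and sub: "R \<subseteq> carrier G" "C \<subseteq> U" "s \<in> carrier G"
    and RU: "\<And>x. x \<in> R \<Longrightarrow> inv x \<otimes> s \<in> U" and big: "card U < card R + card C"
    and CG: "C \<subseteq> carrier G"
  obtains r c where "r \<in> R" "c \<in> C" "r \<otimes> c = s"
proof -
  have "inj_on (\<lambda>x. inv x \<otimes> s) R"
    using sub by (intro inj_onI) (metis inv_closed inv_inv r_cancel subsetD)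
  then have "card ((\<lambda>x. inv x \<otimes> s) ` R) = card R" by (rule card_image)
  then have "(\<lambda>x. inv x \<otimes> s) ` R \<inter> C \<noteq> {}"
    using U RU sub big by (intro Int_nonempty_if_card_gt[of U]) auto
  then obtain r where r: "r \<in> R" "inv r \<otimes> s \<in> C" by auto
  moreover have "r \<otimes> (inv r \<otimes> s) = s" using r sub by (simp add: m_assoc[symmetric] subset_iff)
  ultimately show ?thesis using that by blast
qed

end

section \<open>From a short maximal partial transversal to index two and parity\<close>

theorem theorem5p5:
  fixes G (structure) and n l :: nat and T :: "('a \<times> 'a \<times> 'a) set"
  assumes "group G" and "finite (carrier G)" and "order G = n"
    and "maximal_partial_transversal (cayley_table G) T"
    and "card T = l"
    and "real l < 3 / 5 * real n"
  shows "even n \<and>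
         (\<exists>H. subgroup H G \<and> card (rcosets\<^bsub>G\<^esub> H) = 2) \<and>
         even (int l - int n div 2)"
proof -
  interpret group G by fact
  note fin = assms(2)
  have T: "T \<subseteq> cayley_table G" "inj_on (\<lambda>(r, c, s). r) T" "inj_on (\<lambda>(r, c, s). c) T"
      "inj_on (\<lambda>(r, c, s). s) T"
    using assms(4) by (auto simp: maximal_partial_transversal_def partial_transversal_def)
  have T_mem: "g \<in> carrier G \<and> h \<in> carrier G \<and> k = g \<otimes> h" if "(g, h, k) \<in> T" for g h k
    using T(1) that by (auto simp: cayley_table_def)
  have "T \<subseteq> carrier G \<times> carrier G \<times> carrier G" using T_mem by auto
  then have finT: "finite T" using fin by (meson finite_SigmaI finite_subset)
  define R where "R = carrier G - (\<lambda>(r, c, s). r) ` T"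
  define C where "C = carrier G - (\<lambda>(r, c, s). c) ` T"
  define S where "S = carrier G - (\<lambda>(r, c, s). s) ` T"
  have imG: "(\<lambda>(r, c, s). r) ` T \<subseteq> carrier G" "(\<lambda>(r, c, s). c) ` T \<subseteq> carrier G"
      "(\<lambda>(r, c, s). s) ` T \<subseteq> carrier G"
    using T_mem by auto
  have cardRCS: "card R = n - l" "card C = n - l" "card S = n - l"
    using imG T finT assms(3,5) unfolding R_def C_def S_def order_def
    by (simp_all add: card_Diff_subset card_image)
  have RG: "R \<subseteq> carrier G" and CG: "C \<subseteq> carrier G" and SG: "S \<subseteq> carrier G"
    by (auto simp: R_def C_def S_def)
  have finRCS: "finite R" "finite C" "finite S" using fin by (auto simp: R_def C_def S_def)
  have ln: "5 * l < 3 * n" using assms(6) by linarith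
  then have "R \<noteq> {}" "C \<noteq> {}" "S \<noteq> {}" using cardRCS by auto
  then obtain r0 c0 s0 where rcs0: "r0 \<in> R" "c0 \<in> C" "s0 \<in> S" by blast
  have inj_insert: "inj_on f (insert t T)" if "inj_on f T" "f t \<notin> f ` T"
    for f :: "'a \<times> 'a \<times> 'a \<Rightarrow> 'a" and t
    using that by auto
  have disj: "r \<otimes> c \<notin> S" if rc: "r \<in> R" "c \<in> C" for r c
  proof
    assume S: "r \<otimes> c \<in> S"
    let ?T = "insert (r, c, r \<otimes> c) T"
    have "partial_transversal (cayley_table G) ?T"
      unfolding partial_transversal_def
    proof (intro conjI inj_insert)
      show "?T \<subseteq> cayley_table G" using rc T RG CG by (auto simp: cayley_table_def)
    qed (use T rc S in \<open>simp_all add: R_def C_def S_def\<close>)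
    moreover have "(r, c, r \<otimes> c) \<notin> T" using rc by (force simp: R_def)
    then have "card T < card ?T" using finT by simp
    ultimately show False
      using assms(4) unfolding maximal_partial_transversal_def by blast
  qed
  \<comment> \<open>The products avoid \<open>S\<close>, leaving at most \<open>l\<close> values,
    and \<open>5 * l < 3 * n\<close> is the same as 2l < 3(n - l).\<close>
  have small: "2 * card (R <#> C) < 3 * card R"
  proof -
    have "R <#> C \<subseteq> carrier G - S" using disj RG CG by (auto simp: set_mult_def)
    then have "card (R <#> C) \<le> card (carrier G - S)" using fin by (intro card_mono) auto
    also have "\<dots> = n - (n - l)"
      using SG finRCS cardRCS assms(3) by (simp add: card_Diff_subset order_def)
    finally show ?thesis using cardRCS ln by linarith
  qed
  obtain H where H: "subgroup H G" "card H < 2 * card R"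
    and HR: "\<And>a a'. a \<in> R \<Longrightarrow> a' \<in> R \<Longrightarrow> inv a \<otimes> a' \<in> H"
    and HC: "\<And>b b'. b \<in> C \<Longrightarrow> b' \<in> C \<Longrightarrow> b \<otimes> inv b' \<in> H"
    using small_product_subgroup[OF finRCS(1,2) RG CG _ small] cardRCS by metis
  have HG: "H \<subseteq> carrier G" using H(1) by (rule subgroup.subset)
  \<comment> \<open>If \<open>R\<close> and \<open>C\<close> each filled more than half of the
    group, every element, in particular \<open>s0\<close>, would be a product from \<open>R\<close>
    and \<open>C\<close>.\<close>
  have "2 * card R \<le> n"
  proof (rule ccontr)
    assume "\<not> 2 * card R \<le> n"
    then have "card (carrier G) < card R + card C" using cardRCS assms(3) by (simp add: order_def)
    moreover have "inv x \<otimes> s0 \<in> carrier G" if "x \<in> R" for x using that rcs0 RG SG by auto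
    ultimately obtain r c where "r \<in> R" "c \<in> C" "r \<otimes> c = s0"
      using mult_hits_if_card_gt[OF fin RG CG _ _ _ CG, of s0] rcs0 SG by blast
    then show False using disj rcs0 by blast
  qed
  moreover have "card R \<le> card H"
  proof (rule card_inj_on_le[where f = "\<lambda>x. inv r0 \<otimes> x"])
    show "inj_on (\<lambda>x. inv r0 \<otimes> x) R"
      using rcs0 RG by (intro inj_onI) (metis inv_closed l_cancel subsetD)
  qed (use HR rcs0 HG fin finite_subset in auto)
  ultimately have H_bounds: "card H < n" "2 * n < 5 * card H"
    using H(2) cardRCS ln by linarith+
  have "2 * card H = n"
  proof -
    \<comment> \<open>The index \<open>m\<close> of \<open>H\<close> is squeezed strictly between 1
      and 5/2.\<close>
    obtain m where m: "n = m * card H" using lagrange[OF H(1)] assms(3) by metis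
    have "1 < m" using H_bounds(1) m by (cases m) auto
    moreover have "2 * m * card H < 5 * card H" using H_bounds(2) m by simp
    then have "2 * m < 5" by simp
    ultimately have "m = 2" by linarith
    then show ?thesis using m by simp
  qed
  then have half: "2 * card H = order G" using assms(3) by simp
  note mem = half_subgroup_mult_mem[OF fin H(1) half]
  have inv_mem: "inv x \<in> H \<longleftrightarrow> x \<in> H" if "x \<in> carrier G" for x
    using that mem[of "inv x" x] subgroup.one_closed[OF H(1)] by auto
  have R_coset: "x \<in> H \<longleftrightarrow> r0 \<in> H" if "x \<in> R" for x
    using HR[OF that rcs0(1)] mem[of "inv x" r0] inv_mem that rcs0 RG by auto
  have C_coset: "x \<in> H \<longleftrightarrow> c0 \<in> H" if "x \<in> C" for x
    using HC[OF that rcs0(2)] mem[of x "inv c0"] inv_mem that rcs0 CG by auto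
  \<comment> \<open>If \<open>s\<close> lay in the coset of \<open>r0 \<otimes> c0\<close>, then all
    \<open>inv x \<otimes> s\<close> with \<open>x\<close> in \<open>R\<close> would lie in the
    coset \<open>U\<close> containing \<open>C\<close>. As \<open>card H < 2 * card R\<close>, they
    would meet \<open>C\<close> and make \<open>s\<close> a product.\<close>
  have S_coset: "s \<in> H \<longleftrightarrow> r0 \<otimes> c0 \<notin> H" if s: "s \<in> S" for s
  proof (rule ccontr)
    assume "\<not> ?thesis"
    then have srH: "s \<in> H \<longleftrightarrow> (r0 \<in> H \<longleftrightarrow> c0 \<in> H)" using mem[of r0 c0] rcs0 RG CG by auto
    define U where "U = {x \<in> carrier G. x \<in> H \<longleftrightarrow> c0 \<in> H}"
    have "card U = card H"
    proof (cases "c0 \<in> H")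
      case True
      then have "U = H" using HG by (auto simp: U_def)
      then show ?thesis by simp
    next
      case False
      then have "U = carrier G - H" by (auto simp: U_def)
      then show ?thesis
        using half HG fin by (simp add: card_Diff_subset finite_subset order_def)
    qed
    then have "card U < card R + card C" using H(2) cardRCS by simp
    moreover have "inv x \<otimes> s \<in> U" if "x \<in> R" for x
    proof -
      have xs: "x \<in> carrier G" "s \<in> carrier G" using that s RG SG by auto
      show ?thesis
        using mem[of "inv x" s] inv_mem R_coset[OF that] srH xs by (auto simp: U_def)
    qed
    moreover have "finite U" "C \<subseteq> U" using fin CG C_coset by (auto simp: U_def)
    ultimately obtain r c where "r \<in> R" "c \<in> C" "r \<otimes> c = s"
      using mult_hits_if_card_gt[of U R C s] RG CG SG s by blast
    then show False using disj s by blast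
  qed
  define \<chi> :: "'a \<Rightarrow> int" where "\<chi> = (\<lambda>x. if x \<in> H then 1 else -1)"
  have \<chi>_mult: "\<chi> (x \<otimes> y) = \<chi> x * \<chi> y" if "x \<in> carrier G" "y \<in> carrier G" for x y
    using mem[OF that] by (auto simp: \<chi>_def)
  have \<chi>_sq: "\<chi> x * \<chi> x = 1" for x by (simp add: \<chi>_def)
  have \<chi>_all: "prod \<chi> (carrier G) = (-1) ^ card H"
    using half_subgroup_sign_prod[OF fin H(1) half] by (simp add: \<chi>_def)
  \<comment> \<open>The product of signs over \<open>G\<close> splits into the values that
    \<open>f\<close> takes on \<open>T\<close> and the n - l missed ones, which all have the same
    sign \<open>v\<close>.\<close>
  have prod_missed: "(\<Prod>t\<in>T. \<chi> (f t)) * v ^ (n - l) = (-1) ^ card H"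
    if "inj_on f T" "f ` T \<subseteq> carrier G" "card (carrier G - f ` T) = n - l"
      and v: "\<And>x. x \<in> carrier G - f ` T \<Longrightarrow> \<chi> x = v" for f v
  proof -
    have "prod \<chi> (carrier G) = prod \<chi> (carrier G - f ` T) * prod \<chi> (f ` T)"
      using fin that(2) by (rule prod.subset_diff[rotated])
    also have "prod \<chi> (f ` T) = (\<Prod>t\<in>T. \<chi> (f t))"
      using that(1) by (simp add: prod.reindex)
    also have "prod \<chi> (carrier G - f ` T) = v ^ (n - l)"
      using v that(3) by simp
    finally show ?thesis using \<chi>_all by (simp add: mult.commute)
  qed
  let ?r = "\<lambda>(r, c, s). r" and ?c = "\<lambda>(r, c, s). c" and ?s = "\<lambda>(r, c, s). s"
  have "(\<Prod>t\<in>T. \<chi> (?r t)) * \<chi> r0 ^ (n - l) = (-1) ^ card H"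
    by (rule prod_missed) (use T imG cardRCS R_coset in \<open>auto simp: R_def \<chi>_def\<close>)
  moreover have "(\<Prod>t\<in>T. \<chi> (?c t)) * \<chi> c0 ^ (n - l) = (-1) ^ card H"
    by (rule prod_missed) (use T imG cardRCS C_coset in \<open>auto simp: C_def \<chi>_def\<close>)
  moreover have "(\<Prod>t\<in>T. \<chi> (?s t)) * (- \<chi> (r0 \<otimes> c0)) ^ (n - l) = (-1) ^ card H"
    by (rule prod_missed) (use T imG cardRCS S_coset in \<open>auto simp: S_def \<chi>_def\<close>)
  ultimately have "((\<Prod>t\<in>T. \<chi> (?r t)) * \<chi> r0 ^ (n - l)) * ((\<Prod>t\<in>T. \<chi> (?c t)) * \<chi> c0 ^ (n - l))
      * ((\<Prod>t\<in>T. \<chi> (?s t)) * (- \<chi> (r0 \<otimes> c0)) ^ (n - l)) = (-1) ^ card H * (-1) ^ card H * (-1) ^ card H"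
    by simp
  moreover have "((\<Prod>t\<in>T. \<chi> (?r t)) * \<chi> r0 ^ (n - l)) * ((\<Prod>t\<in>T. \<chi> (?c t)) * \<chi> c0 ^ (n - l))
      * ((\<Prod>t\<in>T. \<chi> (?s t)) * (- \<chi> (r0 \<otimes> c0)) ^ (n - l))
      = (\<Prod>t\<in>T. \<chi> (?r t) * \<chi> (?c t) * \<chi> (?s t)) * (\<chi> r0 * \<chi> c0 * (- \<chi> (r0 \<otimes> c0))) ^ (n - l)"
    by (simp only: prod.distrib power_mult_distrib mult.assoc mult.commute mult.left_commute)
  \<comment> \<open>In each triple the symbol is the product of row and column, so its sign occurs
    squared.\<close>
  moreover have "(\<Prod>t\<in>T. \<chi> (?r t) * \<chi> (?c t) * \<chi> (?s t)) = 1"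
  proof (rule prod.neutral, clarify)
    fix g h k assume "(g, h, k) \<in> T"
    then have "\<chi> k = \<chi> g * \<chi> h" using T_mem \<chi>_mult by blast
    then show "\<chi> g * \<chi> h * \<chi> k = 1" by (simp add: \<chi>_def)
  qed
  \<comment> \<open>The minus sign records that \<open>S\<close> lies in the coset opposite to the
    products; without it the parity information would vanish.\<close>
  moreover have "\<chi> r0 * \<chi> c0 * (- \<chi> (r0 \<otimes> c0)) = -1"
    using \<chi>_mult[of r0 c0] \<chi>_sq rcs0 RG CG by (simp add: \<chi>_def subset_iff)
  ultimately have "(-1 :: int) ^ (n - l) = (-1) ^ (3 * card H)"
    by (simp add: power_mult power3_eq_cube power_mult_distrib[symmetric] power_commutes
        flip: power_add mult_2)
  \<comment> \<open>Since \<open>card H\<close> is n/2 and n is even, this says that l and n/2 have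
    the same parity.\<close>
  then have "even (n - l) \<longleftrightarrow> even (card H)"
    by (cases "even (n - l)"; cases "even (card H)") simp_all
  moreover have "l \<le> n" using ln by simp
  ultimately have "even (int l - int n div 2)"
    using \<open>2 * card H = n\<close> by auto
  then show ?thesis
    using H(1) card_rcosets_half_subgroup[OF fin H(1) half] \<open>2 * card H = n\<close> by auto
qed

end
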